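(* For every $n\ge 1$, the $n$-fold simplicial set $\mathfrak{B}^n\mathbb{F}_1\langle 1\rangle$, i.e. the bar construction $\mathtt{s}^\ast\mathfrak{B}^{n-1}\mathbb{F}_1$, is isomorphic to the $n$-fold simplicial $n$-sphere $\mathfrak{S}^n$.
   Context: $\mathrm{Fin}_\ast$ is the category of the finite pointed sets $\langle n\rangle=\{\ast,1,\dots,n\}$ (basepoint $\ast$) and pointed maps; the smash product is regarded as a functor $\wedge\colon\mathrm{Fin}_\ast\times\mathrm{Fin}_\ast\to\mathrm{Fin}_\ast$, $\langle a\rangle\wedge\langle b\rangle=\langle ab\rangle$ (using, e.g., the lexicographic ordering of pairs). $\mathrm{Mod}_{\mathbb{F}_1}$ is the category of pointed functors $\mathrm{Fin}_\ast\to\mathrm{Set}_\ast$, i.e. those sending $\langle 0\rangle$ to a one-point set, and $\mathbb{F}_1\in\mathrm{Mod}_{\mathbb{F}_1}$ is the inclusion $\mathrm{Fin}_\ast\hookrightarrow\mathrm{Set}_\ast$. For a category $\mathcal{C}$, $s^n\mathcal{C}$ denotes the category of functors $(\Delta^{\mathrm{op}})^n\to\mathcal{C}$; for $\mathcal C=\mathrm{Set}$ these are $n$-fold simplicial sets, and multidegree $[k_1,\dots,k_n]$ means the object $([k_1],\dots,[k_n])$. An object of $s^n\mathrm{Mod}_{\mathbb{F}_1}$ is regarded equivalently as a functor $(\Delta^{\mathrm{op}})^n\times\mathrm{Fin}_\ast\to\mathrm{Set}_\ast$ or as a functor $\mathrm{Fin}_\ast\to s^n\mathrm{Set}_\ast$.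 Let $\mathtt{s}\colon\Delta^{\mathrm{op}}\to\mathrm{Fin}_\ast$ be the pointed simplicial finite set $\Delta^1/\partial\Delta^1$, so $\mathtt{s}[n]=\langle n\rangle$. The delooping functor $\mathfrak{B}\colon s^n\mathrm{Mod}_{\mathbb{F}_1}\to s^{n+1}\mathrm{Mod}_{\mathbb{F}_1}$ is pullback along $\Delta^{\mathrm{op}}\times\mathrm{Fin}_\ast\xrightarrow{\mathtt{s}\times\mathrm{id}}\mathrm{Fin}_\ast\times\mathrm{Fin}_\ast\xrightarrow{\wedge}\mathrm{Fin}_\ast$ in the $\mathrm{Fin}_\ast$ variable, i.e. $(\mathfrak{B}X)([k_1,\dots,k_{n+1}],\langle m\rangle)=X([k_1,\dots,k_n],\langle k_{n+1}\rangle\wedge\langle m\rangle)$, and $\mathfrak{B}^n$ is its $n$-fold iterate (with $\mathfrak{B}^0=\mathrm{id}$). The bar construction of a $\Gamma$-object $X$ (a pointed functor out of $\mathrm{Fin}_\ast$) is $\mathtt{s}^\ast X=X\circ\mathtt{s}$, equivalently $\mathfrak{B}X\langle 1\rangle$. $\square^n\in s^n\mathrm{Set}$ is the free $n$-fold simplicial set on one element in multidegree $[1,1,\dots,1]$ (the functor represented by $([1],\dots,[1])$), $\partial\square^n\subset\square^n$ is the sub-$n$-fold simplicial set generated by all its faces, and $\mathfrak{S}^n=\square^n/\partial\square^n$. *)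

theory Defs
  imports Main "HOL-Library.FuncSet"
begin

section \<open>The categories Fin and Delta\<close>

text \<open>
  The object \<open>\<langle>n\<rangle>\<close> of pointed finite sets is represented by \<open>n\<close>, with underlying set \<open>{0..n}\<close> and
  basepoint \<open>0\<close>; the object \<open>[n]\<close> of Delta is represented by \<open>n\<close>, with underlying ordered set
  \<open>{0..n}\<close>. Morphisms are extensional functions, so that equality of functions is equality of
  morphisms; identities are \<^term>\<open>restrict id {0..n}\<close> and composites are formed with \<^const>\<open>compose\<close>.
\<close>

definition fin_hom :: "nat \<Rightarrow> nat \<Rightarrow> (nat \<Rightarrow> nat) set" where
  "fin_hom m n = {f \<in> {0..m} \<rightarrow>\<^sub>E {0..n}. f 0 = 0}"

definition delta_hom :: "nat \<Rightarrow> nat \<Rightarrow> (nat \<Rightarrow> nat) set" where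
  "delta_hom m n = {f \<in> {0..m} \<rightarrow>\<^sub>E {0..n}. mono_on {0..m} f}"

abbreviation id_map :: "nat \<Rightarrow> nat \<Rightarrow> nat" where
  "id_map n \<equiv> restrict id {0..n}"

text \<open>
  The smash product \<open>\<langle>a\<rangle> \<and> \<langle>b\<rangle> = \<langle>ab\<rangle>\<close>: in the lexicographic order the pair \<open>(i, j)\<close> of
  non-basepoints has position \<open>(i - 1) b + j\<close>.
\<close>

definition smash_elem :: "nat \<Rightarrow> nat \<Rightarrow> nat \<Rightarrow> nat" where
  "smash_elem b i j = (if i = 0 \<or> j = 0 then 0 else (i - 1) * b + j)"

text \<open>\<open>smash_map a b b' f g\<close> is \<open>f \<and> g\<close> for \<open>f\<close> with domain \<open>\<langle>a\<rangle>\<close> and \<open>g : \<langle>b\<rangle> \<rightarrow> \<langle>b'\<rangle>\<close>.\<close>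

definition smash_map ::
  "nat \<Rightarrow> nat \<Rightarrow> nat \<Rightarrow> (nat \<Rightarrow> nat) \<Rightarrow> (nat \<Rightarrow> nat) \<Rightarrow> nat \<Rightarrow> nat" where
  "smash_map a b b' f g =
     (\<lambda>p\<in>{0..a * b}. if p = 0 then 0
        else smash_elem b' (f ((p - 1) div b + 1)) (g ((p - 1) mod b + 1)))"

section \<open>The simplicial circle\<close>

text \<open>
  The \<open>n\<close>-simplices of \<open>\<Delta>\<^sup>1\<close> are the maps \<open>[n] \<rightarrow> [1]\<close>; those of \<open>\<partial>\<Delta>\<^sup>1\<close> are the two constant
  maps. The identification of the \<open>n\<close>-simplices of \<open>\<Delta>\<^sup>1/\<partial>\<Delta>\<^sup>1\<close> with \<open>\<langle>n\<rangle>\<close> sends the class of \<open>\<partial>\<Delta>\<^sup>1\<close>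
  to the basepoint and a non-constant map to the first position at which its value is \<open>1\<close>.
\<close>

definition circle_simplex :: "nat \<Rightarrow> nat \<Rightarrow> nat \<Rightarrow> nat" where
  "circle_simplex n i = (\<lambda>j\<in>{0..n}. if i \<le> j then 1 else 0)"

definition circle_index :: "nat \<Rightarrow> (nat \<Rightarrow> nat) \<Rightarrow> nat" where
  "circle_index n f =
     (if \<exists>c\<in>{0..1}. f = (\<lambda>j\<in>{0..n}. c) then 0 else (LEAST j. j \<le> n \<and> f j = 1))"

text \<open>
  For \<open>\<alpha> : [n'] \<rightarrow> [n]\<close> in Delta, \<open>s_map n n' \<alpha> : \<langle>n\<rangle> \<rightarrow> \<langle>n'\<rangle>\<close> is the operator induced by
  precomposition with \<open>\<alpha>\<close>.
\<close>

definition s_map :: "nat \<Rightarrow> nat \<Rightarrow> (nat \<Rightarrow> nat) \<Rightarrow> nat \<Rightarrow> nat" where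
  "s_map n n' \<alpha> =
     (\<lambda>i\<in>{0..n}. if i = 0 then 0
        else circle_index n' (compose {0..n'} (circle_simplex n i) \<alpha>))"

section \<open>Multisimplicial sets\<close>

text \<open>
  A multidegree \<open>[k\<^sub>1,\<dots>,k\<^sub>n]\<close> is a list of length \<open>n\<close>; a morphism of \<open>\<Delta>\<^sup>n\<close> is a list of morphisms.
\<close>

definition multi_hom :: "nat list \<Rightarrow> nat list \<Rightarrow> (nat \<Rightarrow> nat) list set" where
  "multi_hom ks ls = {fs. length ks = length ls \<and> length fs = length ks \<and>
     (\<forall>i<length ks. fs ! i \<in> delta_hom (ks ! i) (ls ! i))}"

definition multi_id :: "nat list \<Rightarrow> (nat \<Rightarrow> nat) list" where
  "multi_id ks = map id_map ks"

text \<open>\<open>multi_comp ks gs fs\<close> is \<open>gs \<circ> fs\<close>, where \<open>fs\<close> has source \<open>ks\<close>.\<close>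

definition multi_comp ::
  "nat list \<Rightarrow> (nat \<Rightarrow> nat) list \<Rightarrow> (nat \<Rightarrow> nat) list \<Rightarrow> (nat \<Rightarrow> nat) list" where
  "multi_comp ks gs fs = map (\<lambda>i. compose {0..ks ! i} (gs ! i) (fs ! i)) [0..<length ks]"

text \<open>
  The data of a set-valued functor on \<open>(\<Delta>\<^sup>o\<^sup>p)\<^sup>n\<close>. For \<open>fs : ls \<rightarrow> ks\<close> in \<open>\<Delta>\<^sup>n\<close>, the induced map from
  \<open>cells X ks\<close> to \<open>cells X ls\<close> is \<open>oper X ks ls fs\<close>.
\<close>

record 'a msset =
  cells :: "nat list \<Rightarrow> 'a set"
  oper :: "nat list \<Rightarrow> nat list \<Rightarrow> (nat \<Rightarrow> nat) list \<Rightarrow> 'a \<Rightarrow> 'a"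

definition nfold_sset :: "nat \<Rightarrow> 'a msset \<Rightarrow> bool" where
  "nfold_sset n X \<longleftrightarrow>
     (\<forall>ks ls fs. length ks = n \<longrightarrow> length ls = n \<longrightarrow> fs \<in> multi_hom ls ks \<longrightarrow>
        oper X ks ls fs \<in> cells X ks \<rightarrow> cells X ls) \<and>
     (\<forall>ks. length ks = n \<longrightarrow> (\<forall>x\<in>cells X ks. oper X ks ks (multi_id ks) x = x)) \<and>
     (\<forall>ks ls ms fs gs. length ks = n \<longrightarrow> length ls = n \<longrightarrow> length ms = n \<longrightarrow>
        fs \<in> multi_hom ls ks \<longrightarrow> gs \<in> multi_hom ms ls \<longrightarrow>
        (\<forall>x\<in>cells X ks.
           oper X ks ms (multi_comp ms fs gs) x = oper X ls ms gs (oper X ks ls fs x)))"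

definition nfold_iso :: "nat \<Rightarrow> 'a msset \<Rightarrow> 'b msset \<Rightarrow> bool" where
  "nfold_iso n X Y \<longleftrightarrow> nfold_sset n X \<and> nfold_sset n Y \<and>
     (\<exists>\<phi>. (\<forall>ks. length ks = n \<longrightarrow> bij_betw (\<phi> ks) (cells X ks) (cells Y ks)) \<and>
          (\<forall>ks ls fs. length ks = n \<longrightarrow> length ls = n \<longrightarrow> fs \<in> multi_hom ls ks \<longrightarrow>
             (\<forall>x\<in>cells X ks. \<phi> ls (oper X ks ls fs x) = oper Y ks ls fs (\<phi> ks x))))"

text \<open>The subobject generated by a set \<open>G\<close> of cells, each given together with its multidegree.\<close>

inductive_set generated :: "'a msset \<Rightarrow> (nat list \<times> 'a) set \<Rightarrow> (nat list \<times> 'a) set"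
  for X :: "'a msset" and G :: "(nat list \<times> 'a) set" where
  gen: "(ks, x) \<in> G \<Longrightarrow> (ks, x) \<in> generated X G"
| oper: "(ks, x) \<in> generated X G \<Longrightarrow> fs \<in> multi_hom ls ks \<Longrightarrow>
           (ls, oper X ks ls fs x) \<in> generated X G"

text \<open>
  The quotient of \<open>X\<close> by a subobject \<open>A\<close>, collapsing \<open>A\<close> to a point in each multidegree in which it
  is nonempty.
\<close>

definition collapse_rel :: "'a msset \<Rightarrow> (nat list \<times> 'a) set \<Rightarrow> nat list \<Rightarrow> 'a rel" where
  "collapse_rel X A ks = {(x, y). x \<in> cells X ks \<and> y \<in> cells X ks \<and>
     (x = y \<or> (ks, x) \<in> A \<and> (ks, y) \<in> A)}"

definition collapse :: "'a msset \<Rightarrow> (nat list \<times> 'a) set \<Rightarrow> 'a set msset" where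
  "collapse X A =
     \<lparr>cells = (\<lambda>ks. cells X ks // collapse_rel X A ks),
      oper = (\<lambda>ks ls fs C. collapse_rel X A ls `` (oper X ks ls fs ` C))\<rparr>"

definition square :: "nat \<Rightarrow> (nat \<Rightarrow> nat) list msset" where
  "square n =
     \<lparr>cells = (\<lambda>ks. multi_hom ks (replicate n 1)),
      oper = (\<lambda>ks ls fs x. multi_comp ls x fs)\<rparr>"

text \<open>
  The faces of the generator (the identity of \<open>([1],\<dots>,[1])\<close>) are obtained by restricting along one
  of the two maps \<open>[0] \<rightarrow> [1]\<close> in one of the \<open>n\<close> simplicial directions.
\<close>

definition square_faces :: "nat \<Rightarrow> (nat list \<times> (nat \<Rightarrow> nat) list) set" where
  "square_faces n =
     {((replicate n 1)[i := 0],
       oper (square n) (replicate n 1) ((replicate n 1)[i := 0])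
         ((multi_id (replicate n 1))[i := \<delta>]) (multi_id (replicate n 1)))
      | i \<delta>. i < n \<and> \<delta> \<in> delta_hom 0 1}"

definition square_boundary :: "nat \<Rightarrow> (nat list \<times> (nat \<Rightarrow> nat) list) set" where
  "square_boundary n = generated (square n) (square_faces n)"

definition sphere :: "nat \<Rightarrow> (nat \<Rightarrow> nat) list set msset" where
  "sphere n = collapse (square n) (square_boundary n)"

section \<open>Multisimplicial modules over the field with one element\<close>

text \<open>
  The data of a pointed-set-valued functor on \<open>(\<Delta>\<^sup>o\<^sup>p)\<^sup>n \<times> Fin\<close>. For \<open>fs : ls \<rightarrow> ks\<close> in \<open>\<Delta>\<^sup>n\<close> and
  \<open>g : \<langle>m\<rangle> \<rightarrow> \<langle>p\<rangle>\<close>, the induced map from \<open>elems X ks m\<close> to \<open>elems X ls p\<close> is \<open>act X ks m ls p fs g\<close>.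
\<close>

record 'a smod =
  elems :: "nat list \<Rightarrow> nat \<Rightarrow> 'a set"
  pt :: "nat list \<Rightarrow> nat \<Rightarrow> 'a"
  act :: "nat list \<Rightarrow> nat \<Rightarrow> nat list \<Rightarrow> nat \<Rightarrow> (nat \<Rightarrow> nat) list \<Rightarrow> (nat \<Rightarrow> nat) \<Rightarrow> 'a \<Rightarrow> 'a"

definition nfold_module :: "nat \<Rightarrow> 'a smod \<Rightarrow> bool" where
  "nfold_module n X \<longleftrightarrow>
     (\<forall>ks m. length ks = n \<longrightarrow> pt X ks m \<in> elems X ks m) \<and>
     (\<forall>ks. length ks = n \<longrightarrow> elems X ks 0 = {pt X ks 0}) \<and>
     (\<forall>ks m ls p fs g. length ks = n \<longrightarrow> length ls = n \<longrightarrow>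
        fs \<in> multi_hom ls ks \<longrightarrow> g \<in> fin_hom m p \<longrightarrow>
        act X ks m ls p fs g \<in> elems X ks m \<rightarrow> elems X ls p \<and>
        act X ks m ls p fs g (pt X ks m) = pt X ls p) \<and>
     (\<forall>ks m. length ks = n \<longrightarrow>
        (\<forall>x\<in>elems X ks m. act X ks m ks m (multi_id ks) (id_map m) x = x)) \<and>
     (\<forall>ks m ls p ms q fs g fs' g'. length ks = n \<longrightarrow> length ls = n \<longrightarrow> length ms = n \<longrightarrow>
        fs \<in> multi_hom ls ks \<longrightarrow> g \<in> fin_hom m p \<longrightarrow>
        fs' \<in> multi_hom ms ls \<longrightarrow> g' \<in> fin_hom p q \<longrightarrow>
        (\<forall>x\<in>elems X ks m.
           act X ks m ms q (multi_comp ms fs fs') (compose {0..m} g' g) x =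
           act X ls p ms q fs' g' (act X ks m ls p fs g x)))"

definition F1 :: "nat smod" where
  "F1 = \<lparr>elems = (\<lambda>ks m. {0..m}), pt = (\<lambda>ks m. 0), act = (\<lambda>ks m ls p fs g. g)\<rparr>"

text \<open>The new simplicial direction is the last entry of the multidegree.\<close>

definition deloop :: "'a smod \<Rightarrow> 'a smod" where
  "deloop X =
     \<lparr>elems = (\<lambda>ks m. elems X (butlast ks) (last ks * m)),
      pt = (\<lambda>ks m. pt X (butlast ks) (last ks * m)),
      act = (\<lambda>ks m ls p fs g.
        act X (butlast ks) (last ks * m) (butlast ls) (last ls * p) (butlast fs)
          (smash_map (last ks) m p (s_map (last ks) (last ls) (last fs)) g))\<rparr>"

text \<open>The underlying multisimplicial set of \<open>X\<langle>m\<rangle>\<close>.\<close>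

definition level :: "'a smod \<Rightarrow> nat \<Rightarrow> 'a msset" where
  "level X m =
     \<lparr>cells = (\<lambda>ks. elems X ks m), oper = (\<lambda>ks ls fs. act X ks m ls m fs (id_map m))\<rparr>"

text \<open>The bar construction, i.e. pullback along the simplicial circle.\<close>

definition bar :: "'a smod \<Rightarrow> 'a msset" where
  "bar X =
     \<lparr>cells = (\<lambda>ks. elems X (butlast ks) (last ks)),
      oper = (\<lambda>ks ls fs. act X (butlast ks) (last ks) (butlast ls) (last ls) (butlast fs)
                (s_map (last ks) (last ls) (last fs)))\<rparr>"

section \<open>Functoriality of iterated deloopings\<close>

lemma delta_homD:
  assumes "\<alpha> \<in> delta_hom m n"
  shows "j \<le> m \<Longrightarrow> \<alpha> j \<le> n" "i \<le> j \<Longrightarrow> j \<le> m \<Longrightarrow> \<alpha> i \<le> \<alpha> j" "\<alpha> \<in> {0..m} \<rightarrow>\<^sub>E {0..n}"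
  using assms by (auto simp: delta_hom_def mono_on_def PiE_def Pi_def)

lemma fin_homD:
  assumes "f \<in> fin_hom m n"
  shows "i \<le> m \<Longrightarrow> f i \<le> n" "f 0 = 0" "f \<in> extensional {0..m}"
  using assms by (auto simp: fin_hom_def PiE_def Pi_def)

lemma circle_cases:
  assumes "\<alpha> \<in> delta_hom l k"
  obtains (const) "circle_index l (compose {0..l} (circle_simplex k i) \<alpha>) = 0"
      "\<exists>c\<in>{0..1}. compose {0..l} (circle_simplex k i) \<alpha> = (\<lambda>j\<in>{0..l}. c)"
  | (index) e where "circle_index l (compose {0..l} (circle_simplex k i) \<alpha>) = e"
      "1 \<le> e" "e \<le> l" "compose {0..l} (circle_simplex k i) \<alpha> = circle_simplex l e"
proof (cases "\<exists>c\<in>{0..1::nat}. compose {0..l} (circle_simplex k i) \<alpha> = (\<lambda>j\<in>{0..l}. c)")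
  case True
  then show ?thesis using const by (simp add: circle_index_def)
next
  case False
  let ?f = "compose {0..l} (circle_simplex k i) \<alpha>"
  have fv: "?f j = (if i \<le> \<alpha> j then 1 else 0)" if "j \<le> l" for j
    using that delta_homD(1)[OF assms that] by (simp add: compose_def circle_simplex_def)
  have ex: "\<exists>j. j \<le> l \<and> ?f j = 1"
  proof (rule ccontr)
    assume "\<not> ?thesis"
    then have "?f = (\<lambda>j\<in>{0..l}. 0)" using fv by (intro ext) (auto simp: compose_def)
    then show False using False by fastforce
  qed
  define e where "e = (LEAST j. j \<le> l \<and> ?f j = 1)"
  from LeastI_ex[OF ex] have e: "e \<le> l" "?f e = 1" unfolding e_def by blast+
  have least: "?f j \<noteq> 1" if "j < e" "j \<le> l" for j
    using not_less_Least[of j "\<lambda>j. j \<le> l \<and> ?f j = 1"] that unfolding e_def by blast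
  have ie: "i \<le> \<alpha> e" using e(2) unfolding fv[OF e(1)] by (simp split: if_splits)
  have e1: "e \<noteq> 0"
  proof
    assume z: "e = 0"
    have "?f = (\<lambda>j\<in>{0..l}. 1)"
    proof
      fix j
      have "i \<le> \<alpha> 0" using ie z by simp
      then have "i \<le> \<alpha> j" if "j \<le> l" using delta_homD(2)[OF assms, of 0 j] that by simp
      then show "?f j = (\<lambda>j\<in>{0..l}. 1) j" by (cases "j \<le> l") (simp_all add: fv, simp add: compose_def)
    qed
    then show False using False by fastforce
  qed
  have "?f j = circle_simplex l e j" for j
  proof (cases "j \<le> l")
    case True
    show ?thesis
    proof (cases "e \<le> j")
      case t: True
      have "i \<le> \<alpha> j" using ie delta_homD(2)[OF assms t True] by simp
      then show ?thesis using fv True t by (simp add: circle_simplex_def)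
    next
      case f: False
      then have "?f j \<noteq> 1" using least True by auto
      then show ?thesis using fv[OF True] True f
        by (auto simp: circle_simplex_def split: if_splits)
    qed
  qed (simp add: compose_def circle_simplex_def)
  then have "?f = circle_simplex l e" by blast
  moreover have "circle_index l ?f = e" using False by (simp add: circle_index_def e_def)
  ultimately show ?thesis using e1 e(1) by (intro index) auto
qed

lemma circle_index_simplex:
  assumes "1 \<le> i" "i \<le> n"
  shows "circle_index n (circle_simplex n i) = i"
proof -
  have "circle_simplex n i \<noteq> (\<lambda>j\<in>{0..n}. c)" for c
  proof
    assume "circle_simplex n i = (\<lambda>j\<in>{0..n}. c)"
    then have "circle_simplex n i 0 = (\<lambda>j\<in>{0..n}. c) 0" "circle_simplex n i i = (\<lambda>j\<in>{0..n}. c) i"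
      by simp_all
    then show False using assms by (simp add: circle_simplex_def)
  qed
  moreover have "(LEAST j. j \<le> n \<and> circle_simplex n i j = 1) = i"
  proof (rule Least_equality)
    show "i \<le> n \<and> circle_simplex n i i = 1" using assms by (simp add: circle_simplex_def)
    show "i \<le> j" if "j \<le> n \<and> circle_simplex n i j = 1" for j
      using that by (auto simp: circle_simplex_def split: if_splits)
  qed
  ultimately show ?thesis by (simp add: circle_index_def)
qed

lemma s_map_hom:
  assumes "\<alpha> \<in> delta_hom l k"
  shows "s_map k l \<alpha> \<in> fin_hom k l"
proof -
  have "circle_index l (compose {0..l} (circle_simplex k i) \<alpha>) \<le> l" for i
    by (rule circle_cases[OF assms, of i]) auto
  then show ?thesis by (auto simp: s_map_def fin_hom_def)
qed

lemma s_map_id: "s_map k k (id_map k) = id_map k"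
proof -
  have "compose {0..k} (circle_simplex k i) (id_map k) = circle_simplex k i" for i
    by (auto simp: compose_def circle_simplex_def)
  then show ?thesis by (auto simp: s_map_def circle_index_simplex)
qed

lemma s_map_comp:
  assumes \<alpha>: "\<alpha> \<in> delta_hom l k" and \<beta>: "\<beta> \<in> delta_hom m l"
  shows "s_map k m (compose {0..m} \<alpha> \<beta>) = compose {0..k} (s_map l m \<beta>) (s_map k l \<alpha>)"
proof
  fix i
  have bl: "j \<le> m \<Longrightarrow> \<beta> j \<le> l" for j using delta_homD(1)[OF \<beta>] by simp
  have assoc: "compose {0..m} (circle_simplex k i) (compose {0..m} \<alpha> \<beta>) =
      compose {0..m} (compose {0..l} (circle_simplex k i) \<alpha>) \<beta>"
    using bl by (auto simp: compose_def)
  show "s_map k m (compose {0..m} \<alpha> \<beta>) i = compose {0..k} (s_map l m \<beta>) (s_map k l \<alpha>) i"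
  proof (cases "1 \<le> i \<and> i \<le> k")
    case True
    show ?thesis
    proof (rule circle_cases[OF \<alpha>, of i])
      assume z: "circle_index l (compose {0..l} (circle_simplex k i) \<alpha>) = 0"
      assume "\<exists>c\<in>{0..1}. compose {0..l} (circle_simplex k i) \<alpha> = (\<lambda>j\<in>{0..l}. c)"
      then obtain c where c: "c \<in> {0..1}" "compose {0..l} (circle_simplex k i) \<alpha> = (\<lambda>j\<in>{0..l}. c)"
        by blast
      then have "compose {0..m} (compose {0..l} (circle_simplex k i) \<alpha>) \<beta> = (\<lambda>j\<in>{0..m}. c)"
        using bl by (auto simp: compose_def)
      then show ?thesis using True c(1) z unfolding s_map_def
        by (auto simp: assoc circle_index_def compose_eq)
    next
      fix e assume "circle_index l (compose {0..l} (circle_simplex k i) \<alpha>) = e"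
        "1 \<le> e" "e \<le> l" "compose {0..l} (circle_simplex k i) \<alpha> = circle_simplex l e"
      then show ?thesis using True unfolding s_map_def by (auto simp: assoc compose_eq)
    qed
  qed (auto simp: s_map_def compose_def)
qed

lemma smash_elem_le: "i \<le> a \<Longrightarrow> j \<le> b \<Longrightarrow> smash_elem b i j \<le> a * b"
proof -
  assume "i \<le> a" "j \<le> b"
  then have "(i - 1) * b + j \<le> i * b" if "i > 0" using that by (cases i) auto
  moreover have "i * b \<le> a * b" using \<open>i \<le> a\<close> by simp
  ultimately show ?thesis by (cases "i = 0") (auto simp: smash_elem_def intro: le_trans)
qed

lemma smash_map_elem:
  assumes "i \<le> a" "j \<le> b" "f 0 = 0" "g 0 = 0"
  shows "smash_map a b b' f g (smash_elem b i j) = smash_elem b' (f i) (g j)"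
proof (cases "i = 0 \<or> j = 0")
  case False
  then obtain i' j' where ij: "i = Suc i'" "j = Suc j'" by (metis not0_implies_Suc)
  have "smash_elem b i j - 1 = i' * b + j'" "smash_elem b i j \<noteq> 0" using ij by (auto simp: smash_elem_def)
  moreover have "j' < b" using assms ij by simp
  ultimately show ?thesis using smash_elem_le[OF assms(1,2)] ij by (simp add: smash_map_def)
qed (use assms in \<open>auto simp: smash_map_def smash_elem_def\<close>)

lemma smash_elem_surj:
  assumes "p \<le> a * b"
  obtains i j where "i \<le> a" "j \<le> b" "p = smash_elem b i j"
proof (cases "p = 0")
  case True
  then show ?thesis using that[of 0 0] by (simp add: smash_elem_def)
next
  case False
  then have b: "b > 0" using assms by (cases b) auto
  have "p - 1 < a * b" using False assms by simp
  then have "(p - 1) div b < a" using b by (simp add: less_mult_imp_div_less)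
  then show ?thesis using False b that[of "(p - 1) div b + 1" "(p - 1) mod b + 1"]
    by (simp add: smash_elem_def Suc_leI)
qed

lemma smash_map_hom:
  assumes "f \<in> fin_hom a a'" "g \<in> fin_hom b b'"
  shows "smash_map a b b' f g \<in> fin_hom (a * b) (a' * b')"
proof -
  have "smash_map a b b' f g p \<le> a' * b'" if p: "p \<le> a * b" for p
  proof -
    from smash_elem_surj[OF p] obtain i j where "i \<le> a" "j \<le> b" "p = smash_elem b i j" .
    then show ?thesis using fin_homD[OF assms(1)] fin_homD[OF assms(2)]
      by (simp add: smash_map_elem smash_elem_le)
  qed
  then show ?thesis by (auto simp: fin_hom_def PiE_def smash_map_def)
qed

lemma smash_map_id: "smash_map a b b (id_map a) (id_map b) = id_map (a * b)"
proof
  fix p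
  show "smash_map a b b (id_map a) (id_map b) p = id_map (a * b) p"
  proof (cases "p \<le> a * b")
    case True
    from smash_elem_surj[OF True] obtain i j where "i \<le> a" "j \<le> b" "p = smash_elem b i j" .
    then show ?thesis using True by (simp add: smash_map_elem)
  qed (simp add: smash_map_def)
qed

lemma smash_map_comp:
  assumes f: "f \<in> fin_hom a a'" and g: "g \<in> fin_hom b b'"
    and f': "f' \<in> fin_hom a' a''" and g': "g' \<in> fin_hom b' b''"
  shows "smash_map a b b'' (compose {0..a} f' f) (compose {0..b} g' g) =
    compose {0..a * b} (smash_map a' b' b'' f' g') (smash_map a b b' f g)"
proof
  fix p
  show "smash_map a b b'' (compose {0..a} f' f) (compose {0..b} g' g) p =
    compose {0..a * b} (smash_map a' b' b'' f' g') (smash_map a b b' f g) p"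
  proof (cases "p \<le> a * b")
    case True
    from smash_elem_surj[OF True] obtain i j where "i \<le> a" "j \<le> b" "p = smash_elem b i j" .
    then show ?thesis using True fin_homD[OF f] fin_homD[OF g] fin_homD[OF f'] fin_homD[OF g']
      by (simp add: smash_map_elem compose_eq)
  qed (simp add: smash_map_def compose_def)
qed

lemma multi_hom_snoc:
  assumes "fs \<in> multi_hom ls ks" "ks \<noteq> []"
  shows "butlast fs \<in> multi_hom (butlast ls) (butlast ks)"
    and "last fs \<in> delta_hom (last ls) (last ks)"
proof -
  have len: "length ls = length ks" "length fs = length ks"
    and h: "\<And>i. i < length ks \<Longrightarrow> fs ! i \<in> delta_hom (ls ! i) (ks ! i)"
    using assms(1) by (auto simp: multi_hom_def)
  show "butlast fs \<in> multi_hom (butlast ls) (butlast ks)"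
    using len h by (auto simp: multi_hom_def nth_butlast)
  have ne: "ls \<noteq> []" "fs \<noteq> []" using len assms(2) by auto
  show "last fs \<in> delta_hom (last ls) (last ks)"
    using len h[of "length ks - 1"] assms(2) ne by (simp add: last_conv_nth)
qed

lemma multi_comp_snoc:
  assumes "length fs = length ms" "length gs = length ms" "ms \<noteq> []"
  shows "butlast (multi_comp ms fs gs) = multi_comp (butlast ms) (butlast fs) (butlast gs)"
    and "last (multi_comp ms fs gs) = compose {0..last ms} (last fs) (last gs)"
proof -
  show "butlast (multi_comp ms fs gs) = multi_comp (butlast ms) (butlast fs) (butlast gs)"
    using assms by (intro nth_equalityI) (auto simp: multi_comp_def nth_butlast)
  have "fs \<noteq> []" "gs \<noteq> []" using assms by auto
  then show "last (multi_comp ms fs gs) = compose {0..last ms} (last fs) (last gs)"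
    using assms by (simp add: multi_comp_def last_map last_conv_nth)
qed

lemma multi_id_snoc:
  "butlast (multi_id ks) = multi_id (butlast ks)"
  "ks \<noteq> [] \<Longrightarrow> last (multi_id ks) = id_map (last ks)"
  by (auto simp: multi_id_def map_butlast last_map)

lemma nfold_module_F1: "nfold_module 0 F1"
  by (auto simp: nfold_module_def F1_def fin_hom_def compose_eq)

lemma nfold_module_deloop:
  assumes X: "nfold_module n X"
  shows "nfold_module (Suc n) (deloop X)"
proof -
  have len: "length (butlast ks) = n" "ks \<noteq> []" if "length ks = Suc n" for ks :: "nat list"
    using that by auto
  have hom: "butlast fs \<in> multi_hom (butlast ls) (butlast ks)"
      "smash_map (last ks) m p (s_map (last ks) (last ls) (last fs)) g
        \<in> fin_hom (last ks * m) (last ls * p)"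
    if "length ks = Suc n" "fs \<in> multi_hom ls ks" "g \<in> fin_hom m p" for ks ls fs g m p
    using multi_hom_snoc[OF that(2) len(2)[OF that(1)]] that(3)
    by (auto intro: smash_map_hom s_map_hom)
  have comp: "smash_map (last ks) m q
        (s_map (last ks) (last ms) (last (multi_comp ms fs fs'))) (compose {0..m} g' g) =
      compose {0..last ks * m}
        (smash_map (last ls) p q (s_map (last ls) (last ms) (last fs')) g')
        (smash_map (last ks) m p (s_map (last ks) (last ls) (last fs)) g)"
      "butlast (multi_comp ms fs fs') = multi_comp (butlast ms) (butlast fs) (butlast fs')"
    if l: "length ks = Suc n" "length ls = Suc n" "length ms = Suc n" and
      h: "fs \<in> multi_hom ls ks" "g \<in> fin_hom m p" "fs' \<in> multi_hom ms ls" "g' \<in> fin_hom p q"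
    for ks ls ms fs fs' g g' m p q
  proof -
    have le: "length fs = length ms" "length fs' = length ms" "ms \<noteq> []"
      using h(1,3) l by (auto simp: multi_hom_def)
    note 1 = multi_hom_snoc(2)[OF h(1) len(2)[OF l(1)]]
    note 2 = multi_hom_snoc(2)[OF h(3) len(2)[OF l(2)]]
    show "smash_map (last ks) m q
        (s_map (last ks) (last ms) (last (multi_comp ms fs fs'))) (compose {0..m} g' g) =
      compose {0..last ks * m}
        (smash_map (last ls) p q (s_map (last ls) (last ms) (last fs')) g')
        (smash_map (last ks) m p (s_map (last ks) (last ls) (last fs)) g)"
      unfolding multi_comp_snoc(2)[OF le] s_map_comp[OF 1 2]
      by (rule smash_map_comp[OF s_map_hom[OF 1] h(2) s_map_hom[OF 2] h(4)])
    show "butlast (multi_comp ms fs fs') = multi_comp (butlast ms) (butlast fs) (butlast fs')"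
      by (rule multi_comp_snoc(1)[OF le])
  qed
  have X1: "pt X ks m \<in> elems X ks m" "elems X ks 0 = {pt X ks 0}"
      "x \<in> elems X ks m \<Longrightarrow> act X ks m ks m (multi_id ks) (id_map m) x = x"
    if "length ks = n" for ks m x
    using X that by (auto simp: nfold_module_def)
  have X2: "act X ks m ls p fs g \<in> elems X ks m \<rightarrow> elems X ls p"
      "act X ks m ls p fs g (pt X ks m) = pt X ls p"
    if "length ks = n" "length ls = n" "fs \<in> multi_hom ls ks" "g \<in> fin_hom m p"
    for ks m ls p fs g
    using X that by (simp_all add: nfold_module_def)
  have X3: "act X ks m ms q (multi_comp ms fs fs') (compose {0..m} g' g) x =
           act X ls p ms q fs' g' (act X ks m ls p fs g x)"
    if "length ks = n" "length ls = n" "length ms = n" "fs \<in> multi_hom ls ks" "g \<in> fin_hom m p"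
      "fs' \<in> multi_hom ms ls" "g' \<in> fin_hom p q" "x \<in> elems X ks m"
    for ks m ls p ms q fs g fs' g' x
    using X that unfolding nfold_module_def by blast
  show ?thesis
    unfolding nfold_module_def
  proof (intro conjI allI impI ballI)
    fix ks :: "nat list" and m assume l: "length ks = Suc n"
    show "pt (deloop X) ks m \<in> elems (deloop X) ks m"
      using X1(1)[OF len(1)[OF l]] by (simp add: deloop_def)
    show "elems (deloop X) ks 0 = {pt (deloop X) ks 0}"
      using X1(2)[OF len(1)[OF l]] by (simp add: deloop_def)
    fix x assume "x \<in> elems (deloop X) ks m"
    then show "act (deloop X) ks m ks m (multi_id ks) (id_map m) x = x"
      using X1(3)[OF len(1)[OF l]] len[OF l]
      by (simp add: deloop_def multi_id_snoc s_map_id smash_map_id)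
  next
    fix ks m ls p fs g assume l: "length ks = Suc n" "length ls = Suc n"
      and h: "fs \<in> multi_hom ls ks" "g \<in> fin_hom m p"
    note h' = X2[OF len(1)[OF l(1)] len(1)[OF l(2)] hom[OF l(1) h]]
    show "act (deloop X) ks m ls p fs g \<in> elems (deloop X) ks m \<rightarrow> elems (deloop X) ls p"
      using h'(1) by (simp add: deloop_def)
    show "act (deloop X) ks m ls p fs g (pt (deloop X) ks m) = pt (deloop X) ls p"
      using h'(2) by (simp add: deloop_def)
  next
    fix ks m ls p ms q fs g fs' g' x
    assume l: "length ks = Suc n" "length ls = Suc n" "length ms = Suc n"
      and h: "fs \<in> multi_hom ls ks" "g \<in> fin_hom m p" "fs' \<in> multi_hom ms ls" "g' \<in> fin_hom p q"
      and x: "x \<in> elems (deloop X) ks m"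
    have x': "x \<in> elems X (butlast ks) (last ks * m)" using x by (simp add: deloop_def)
    note h' = X3[OF len(1)[OF l(1)] len(1)[OF l(2)] len(1)[OF l(3)] hom[OF l(1) h(1,2)]
      hom[OF l(2) h(3,4)] x']
    show "act (deloop X) ks m ms q (multi_comp ms fs fs') (compose {0..m} g' g) x =
      act (deloop X) ls p ms q fs' g' (act (deloop X) ks m ls p fs g x)"
      using h' by (simp add: deloop_def comp[OF l h])
  qed
qed

corollary nfold_module_deloop_F1: "nfold_module n ((deloop ^^ n) F1)"
  by (induction n) (simp_all add: nfold_module_F1 nfold_module_deloop)

end

theory Submission
  imports Defs
begin

text \<open>
  A simplex \<open>[k] \<rightarrow> [1]\<close> of \<open>\<Delta>\<^sup>1\<close> gives a point of \<open>\<langle>k\<rangle>\<close>, its class in \<open>\<Delta>\<^sup>1/\<partial>\<Delta>\<^sup>1\<close>, and this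
  identifies the non-constant simplices with the points other than the basepoint. A cell of \<open>\<square>\<^sup>n\<close> in
  multidegree \<open>[k\<^sub>1,\<dots>,k\<^sub>n]\<close> is an \<open>n\<close>-tuple of such simplices, so it gives points
  \<open>i\<^sub>r \<in> \<langle>k\<^sub>r\<rangle>\<close>. On the other side, unfolding the deloopings shows that the cells of
  \<open>\<BB>\<^sup>n F1\<langle>1\<rangle>\<close> in this multidegree are the points of \<open>\<langle>k\<^sub>1\<rangle> \<and> \<dots> \<and> \<langle>k\<^sub>n\<rangle> \<and> \<langle>1\<rangle>\<close>. Sending the
  tuple to \<open>i\<^sub>1 \<and> \<dots> \<and> i\<^sub>n \<and> 1\<close> defines the map \<open>cube_index\<close> from the cube to the delooping; since
  \<open>\<square>\<^sup>n\<close> is represented by \<open>([1],\<dots>,[1])\<close>, it is the map that classifies the unique cell of that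
  multidegree other than the basepoint.

  The map respects the multisimplicial structure because taking the class of a simplex does
  (\<open>act_cube_index\<close>), and it is onto because every point of a smash product is a smash of points
  (\<open>cube_index_image\<close>). A smash of points is the basepoint exactly when one of the factors is, and it
  determines its factors otherwise. Hence the only cells that are identified are those in which some
  component is constant, and all of these go to the basepoint (\<open>cube_index_kernel\<close>). They are exactly
  the cells of \<open>\<partial>\<square>\<^sup>n\<close>, because a constant map is one that factors through \<open>[0]\<close>
  (\<open>square_boundary_iff\<close>). So the fibres of \<open>cube_index\<close> are the classes that make up
  \<open>\<square>\<^sup>n/\<partial>\<square>\<^sup>n\<close>, and the general fact \<open>nfold_iso_collapse\<close> turns this into an isomorphism.

  The bar construction differs from the delooping at \<open>\<langle>1\<rangle>\<close> only by the smash factor \<open>\<langle>1\<rangle>\<close>, which is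
  a strict unit on the right for the lexicographic smash product, so the same map serves for both.
\<close>

section \<open>Multisimplicial sets and their quotients\<close>

lemma multi_homD:
  assumes "fs \<in> multi_hom ks ls"
  shows "length fs = length ks" "length ls = length ks"
    and "i < length ks \<Longrightarrow> fs ! i \<in> delta_hom (ks ! i) (ls ! i)"
  using assms by (auto simp: multi_hom_def)

lemma multi_comp_nth:
  "i < length ks \<Longrightarrow> multi_comp ks gs fs ! i = compose {0..ks ! i} (gs ! i) (fs ! i)"
  "length (multi_comp ks gs fs) = length ks"
  by (simp_all add: multi_comp_def)

lemma id_map_delta_hom: "id_map k \<in> delta_hom k k"
  by (auto simp: delta_hom_def mono_on_def)

lemma delta_hom_compose:
  assumes "\<beta> \<in> delta_hom l m" "\<alpha> \<in> delta_hom k l"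
  shows "compose {0..k} \<beta> \<alpha> \<in> delta_hom k m"
  using delta_homD[OF assms(1)] delta_homD[OF assms(2)]
  by (auto simp: delta_hom_def mono_on_def compose_def)

lemma multi_id_hom: "multi_id ks \<in> multi_hom ks ks"
  by (simp add: multi_hom_def multi_id_def id_map_delta_hom del: restrict_apply)

lemma multi_comp_hom:
  assumes "gs \<in> multi_hom ls ms" "fs \<in> multi_hom ks ls"
  shows "multi_comp ks gs fs \<in> multi_hom ks ms"
proof -
  have "compose {0..ks ! i} (gs ! i) (fs ! i) \<in> delta_hom (ks ! i) (ms ! i)"
    if "i < length ks" for i
    using that multi_homD[OF assms(1)] multi_homD[OF assms(2)] by (auto intro: delta_hom_compose)
  then show ?thesis
    using multi_homD[OF assms(1)] multi_homD[OF assms(2)] by (simp add: multi_hom_def multi_comp_nth)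
qed

lemma multi_comp_id_left:
  assumes "fs \<in> multi_hom ks ls"
  shows "multi_comp ks (multi_id ls) fs = fs"
proof (rule nth_equalityI)
  fix i assume "i < length (multi_comp ks (multi_id ls) fs)"
  then have i: "i < length ks" by (simp add: multi_comp_nth)
  note f = multi_homD(3)[OF assms i]
  have "compose {0..ks ! i} (id_map (ls ! i)) (fs ! i) = fs ! i"
    using delta_homD(1)[OF f] delta_homD(3)[OF f]
    by (auto simp: fun_eq_iff compose_def PiE_def extensional_def)
  then show "multi_comp ks (multi_id ls) fs ! i = fs ! i"
    using i multi_homD(2)[OF assms] by (simp add: multi_comp_nth multi_id_def)
qed (use multi_homD[OF assms] in \<open>simp add: multi_comp_nth\<close>)

lemma multi_comp_id_right:
  assumes "fs \<in> multi_hom ks ls"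
  shows "multi_comp ks fs (multi_id ks) = fs"
proof (rule nth_equalityI)
  fix i assume "i < length (multi_comp ks fs (multi_id ks))"
  then have i: "i < length ks" by (simp add: multi_comp_nth)
  note f = multi_homD(3)[OF assms i]
  have "compose {0..ks ! i} (fs ! i) (id_map (ks ! i)) = fs ! i"
    using delta_homD(3)[OF f]
    by (auto simp: fun_eq_iff compose_def PiE_def extensional_def)
  then show "multi_comp ks fs (multi_id ks) ! i = fs ! i"
    using i by (simp add: multi_comp_nth multi_id_def)
qed (use multi_homD[OF assms] in \<open>simp add: multi_comp_nth\<close>)

lemma multi_comp_assoc:
  assumes "gs \<in> multi_hom ls ms" "fs \<in> multi_hom ks ls"
  shows "multi_comp ks hs (multi_comp ks gs fs) = multi_comp ks (multi_comp ls hs gs) fs"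
proof (rule nth_equalityI)
  fix i assume "i < length (multi_comp ks hs (multi_comp ks gs fs))"
  then have i: "i < length ks" by (simp add: multi_comp_nth)
  then show "multi_comp ks hs (multi_comp ks gs fs) ! i = multi_comp ks (multi_comp ls hs gs) fs ! i"
    using delta_homD(1)[OF multi_homD(3)[OF assms(2) i]] multi_homD(2)[OF assms(2)]
    by (auto simp: multi_comp_nth compose_def fun_eq_iff)
qed (simp add: multi_comp_nth)

lemma nfold_sset_square: "nfold_sset n (square n)"
  by (auto simp: nfold_sset_def square_def multi_comp_hom multi_comp_id_right multi_comp_assoc)

text \<open>
  Natural surjections carry functoriality from \<open>X\<close> to a bare record \<open>Y\<close> of cells and operators, since
  every identity between operators of \<open>Y\<close> can be tested on images of cells of \<open>X\<close>. In this way the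
  deloopings, the bar construction and the quotient all inherit it from the cube.
\<close>

definition nfold_surj ::
  "nat \<Rightarrow> 'a msset \<Rightarrow> 'b msset \<Rightarrow> (nat list \<Rightarrow> 'a \<Rightarrow> 'b) \<Rightarrow> bool" where
  "nfold_surj n X Y p \<longleftrightarrow>
     (\<forall>ks. length ks = n \<longrightarrow> p ks ` cells X ks = cells Y ks) \<and>
     (\<forall>ks ls fs. length ks = n \<longrightarrow> length ls = n \<longrightarrow> fs \<in> multi_hom ls ks \<longrightarrow>
        (\<forall>x\<in>cells X ks. p ls (oper X ks ls fs x) = oper Y ks ls fs (p ks x)))"

lemma nfold_sset_image:
  assumes X: "nfold_sset n X" and p: "nfold_surj n X Y p"
  shows "nfold_sset n Y"
proof -
  have im: "p ks ` cells X ks = cells Y ks" if "length ks = n" for ks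
    using p that by (simp add: nfold_surj_def)
  have nat: "oper Y ks ls fs (p ks x) = p ls (oper X ks ls fs x)"
    if "length ks = n" "length ls = n" "fs \<in> multi_hom ls ks" "x \<in> cells X ks" for ks ls fs x
    using p that by (simp add: nfold_surj_def)
  have cl: "oper X ks ls fs x \<in> cells X ls"
    if "length ks = n" "length ls = n" "fs \<in> multi_hom ls ks" "x \<in> cells X ks" for ks ls fs x
    using X that unfolding nfold_sset_def by blast
  have id: "oper X ks ks (multi_id ks) x = x" if "length ks = n" "x \<in> cells X ks" for ks x
    using X that unfolding nfold_sset_def by blast
  have comp: "oper X ks ms (multi_comp ms fs gs) x = oper X ls ms gs (oper X ks ls fs x)"
    if "length ks = n" "length ls = n" "length ms = n" "fs \<in> multi_hom ls ks"
      "gs \<in> multi_hom ms ls" "x \<in> cells X ks" for ks ls ms fs gs x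
    using X that unfolding nfold_sset_def by blast
  show ?thesis
    unfolding nfold_sset_def
  proof (intro conjI allI impI ballI)
    fix ks ls :: "nat list" and fs
    assume a: "length ks = n" "length ls = n" "fs \<in> multi_hom ls ks"
    show "oper Y ks ls fs \<in> cells Y ks \<rightarrow> cells Y ls"
      using nat[OF a] cl[OF a] by (auto simp flip: im[OF a(1)] im[OF a(2)])
  next
    fix ks :: "nat list" and y assume a: "length ks = n" "y \<in> cells Y ks"
    then obtain x where "x \<in> cells X ks" "y = p ks x" using im by blast
    then show "oper Y ks ks (multi_id ks) y = y"
      using a(1) by (simp add: nat id multi_id_hom)
  next
    fix ks ls ms :: "nat list" and fs gs y
    assume a: "length ks = n" "length ls = n" "length ms = n" "fs \<in> multi_hom ls ks"
      "gs \<in> multi_hom ms ls" and "y \<in> cells Y ks"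
    then obtain x where "x \<in> cells X ks" "y = p ks x" using im by blast
    then show "oper Y ks ms (multi_comp ms fs gs) y = oper Y ls ms gs (oper Y ks ls fs y)"
      using a by (simp add: nat cl comp multi_comp_hom)
  qed
qed

text \<open>
  The first isomorphism theorem: if \<open>p\<close> identifies just the cells of \<open>A\<close> with one another, the
  collapsing relation is the kernel of \<open>p\<close>, so its classes are the fibres of \<open>p\<close>. The isomorphism
  takes a cell of \<open>Y\<close> to its fibre.
\<close>

lemma nfold_iso_collapse:
  assumes X: "nfold_sset n X" and p: "nfold_surj n X Y p"
    and ker: "\<And>ks x y. length ks = n \<Longrightarrow> x \<in> cells X ks \<Longrightarrow> y \<in> cells X ks \<Longrightarrow>
      p ks x = p ks y \<longleftrightarrow> x = y \<or> (ks, x) \<in> A \<and> (ks, y) \<in> A"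
  shows "nfold_iso n Y (collapse X A)"
proof -
  define \<phi> where "\<phi> ks y = {x \<in> cells X ks. p ks x = y}" for ks y
  have im: "p ks ` cells X ks = cells Y ks" if "length ks = n" for ks
    using p that by (simp add: nfold_surj_def)
  have nat: "p ls (oper X ks ls fs x) = oper Y ks ls fs (p ks x)"
    if "length ks = n" "length ls = n" "fs \<in> multi_hom ls ks" "x \<in> cells X ks" for ks ls fs x
    using p that by (simp add: nfold_surj_def)
  have cl: "oper X ks ls fs x \<in> cells X ls"
    if "length ks = n" "length ls = n" "fs \<in> multi_hom ls ks" "x \<in> cells X ks" for ks ls fs x
    using X that unfolding nfold_sset_def by blast
  have rel: "collapse_rel X A ks = {(x, y). x \<in> cells X ks \<and> y \<in> cells X ks \<and> p ks x = p ks y}"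
    if "length ks = n" for ks
    using ker[OF that] unfolding collapse_rel_def by blast
  have cls: "collapse_rel X A ks `` {x} = \<phi> ks (p ks x)"
    if "length ks = n" "x \<in> cells X ks" for ks x
    using that by (auto simp: rel \<phi>_def)
  have bij: "bij_betw (\<phi> ks) (cells Y ks) (cells (collapse X A) ks)" if l: "length ks = n" for ks
    unfolding bij_betw_def
  proof
    show "inj_on (\<phi> ks) (cells Y ks)"
      by (rule inj_onI) (auto simp: \<phi>_def simp flip: im[OF l])
    show "\<phi> ks ` cells Y ks = cells (collapse X A) ks"
      using cls[OF l] by (auto simp: collapse_def quotient_def simp flip: im[OF l])
  qed
  have phi_nat: "\<phi> ls (oper Y ks ls fs y) = oper (collapse X A) ks ls fs (\<phi> ks y)"
    if a: "length ks = n" "length ls = n" "fs \<in> multi_hom ls ks" and y: "y \<in> cells Y ks"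
    for ks ls fs y
  proof -
    obtain x where x: "x \<in> cells X ks" "y = p ks x" using im[OF a(1)] y by blast
    have "oper (collapse X A) ks ls fs (\<phi> ks y) =
        {z \<in> cells X ls. \<exists>x\<in>cells X ks. p ks x = y \<and> p ls (oper X ks ls fs x) = p ls z}"
      using cl[OF a] by (auto simp: collapse_def rel[OF a(2)] \<phi>_def)
    also have "\<dots> = \<phi> ls (oper Y ks ls fs y)"
      using x nat[OF a] by (auto simp: \<phi>_def)
    finally show ?thesis ..
  qed
  have Y: "nfold_sset n Y" by (rule nfold_sset_image[OF X p])
  have "nfold_surj n Y (collapse X A) \<phi>"
    using bij phi_nat by (auto simp: nfold_surj_def bij_betw_def)
  then have "nfold_sset n (collapse X A)" by (rule nfold_sset_image[OF Y])
  then show ?thesis using Y bij phi_nat unfolding nfold_iso_def by blast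
qed

section \<open>Simplices of the circle and smash products\<close>

lemma circle_simplex_1: "circle_simplex 1 1 = id_map 1"
  by (auto simp: circle_simplex_def fun_eq_iff)

text \<open>
  Facts about \<open>circle_simplex k i\<close> composed with a map into \<open>[k]\<close> specialise, for \<open>k = i = 1\<close>, to
  facts about an arbitrary simplex of \<open>\<Delta>\<^sup>1\<close>.
\<close>

lemma compose_circle_simplex_1:
  assumes "f \<in> delta_hom k 1"
  shows "compose {0..k} (circle_simplex 1 1) f = f"
  using delta_homD(1)[OF assms] delta_homD(3)[OF assms]
  unfolding circle_simplex_1 by (auto simp: fun_eq_iff compose_def PiE_def extensional_def)

lemma circle_index_cases:
  assumes "f \<in> delta_hom k 1"
  obtains (const) c where "circle_index k f = 0" "c \<le> 1" "f = (\<lambda>j\<in>{0..k}. c)"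
  | (simplex) "1 \<le> circle_index k f" "circle_index k f \<le> k" "f = circle_simplex k (circle_index k f)"
  using circle_cases[OF assms, of 1] that unfolding compose_circle_simplex_1[OF assms]
  by (metis atLeastAtMost_iff)

lemma circle_index_le: "f \<in> delta_hom k 1 \<Longrightarrow> circle_index k f \<le> k"
  by (erule circle_index_cases) auto

lemma circle_index_inj:
  assumes "f \<in> delta_hom k 1" "f' \<in> delta_hom k 1"
    and "circle_index k f = circle_index k f'" "circle_index k f \<noteq> 0"
  shows "f = f'"
  using assms by (metis circle_index_cases)

lemma circle_index_surj:
  assumes "i \<le> k"
  obtains f where "f \<in> delta_hom k 1" "circle_index k f = i"
proof (cases "i = 0")
  case True
  have "(\<lambda>j\<in>{0..k}. 0) \<in> delta_hom k 1" by (auto simp: delta_hom_def mono_on_def)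
  moreover have "circle_index k (\<lambda>j\<in>{0..k}. 0) = 0" by (auto simp: circle_index_def)
  ultimately show ?thesis using that True by blast
next
  case False
  have "circle_simplex k i \<in> delta_hom k 1"
    by (auto simp: delta_hom_def mono_on_def circle_simplex_def)
  then show ?thesis using that False assms circle_index_simplex[of i k] by auto
qed

lemma circle_index_eq_s_map:
  assumes "f \<in> delta_hom k 1"
  shows "circle_index k f = s_map 1 k f 1"
  using compose_circle_simplex_1[OF assms] by (simp add: s_map_def)

text \<open>
  By the Yoneda lemma the class of a simplex \<open>f : [k] \<rightarrow> [1]\<close> in \<open>\<Delta>\<^sup>1/\<partial>\<Delta>\<^sup>1\<close> is the pullback along \<open>f\<close>
  of the class \<open>1 \<in> \<langle>1\<rangle>\<close> of the identity. Naturality of the class is therefore functoriality of the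
  circle.
\<close>

lemma circle_index_compose:
  assumes f: "f \<in> delta_hom k 1" and \<alpha>: "\<alpha> \<in> delta_hom l k"
  shows "circle_index l (compose {0..l} f \<alpha>) = s_map k l \<alpha> (circle_index k f)"
  unfolding circle_index_eq_s_map[OF f] circle_index_eq_s_map[OF delta_hom_compose[OF f \<alpha>]]
    s_map_comp[OF f \<alpha>] by (simp add: compose_eq)

lemma smash_elem_eq_0_iff: "smash_elem b i j = 0 \<longleftrightarrow> i = 0 \<or> j = 0"
  by (simp add: smash_elem_def)

text \<open>
  Away from the basepoint, the position \<open>(i - 1) b + j\<close> determines \<open>i - 1\<close> and \<open>j - 1\<close> as quotient
  and remainder of division by \<open>b\<close>.
\<close>

lemma smash_elem_inj:
  assumes eq: "smash_elem b i j = smash_elem b i' j'" "smash_elem b i j \<noteq> 0"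
    and "j \<le> b" "j' \<le> b"
  shows "i = i' \<and> j = j'"
proof -
  have nz: "i \<noteq> 0" "j \<noteq> 0" "i' \<noteq> 0" "j' \<noteq> 0" using eq by (metis smash_elem_eq_0_iff)+
  then obtain r s r' s' where *: "i = Suc r" "j = Suc s" "i' = Suc r'" "j' = Suc s'"
    by (metis not0_implies_Suc)
  have less: "s < b" "s' < b" using assms(3,4) * by auto
  have e: "r * b + s = r' * b + s'" using eq(1) * by (simp add: smash_elem_def)
  have "r = (r * b + s) div b" using less by simp
  also have "\<dots> = r'" using less unfolding e by simp
  finally show ?thesis using e * by simp
qed

lemma smash_map_unit_right:
  assumes "f \<in> fin_hom a a'"
  shows "smash_map a 1 1 f (id_map 1) = f"
proof
  fix i
  show "smash_map a 1 1 f (id_map 1) i = f i"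
  proof (cases "i \<le> a")
    case True
    then show ?thesis using fin_homD(2)[OF assms]
      by (auto simp: smash_map_def smash_elem_def)
  next
    case False
    then show ?thesis using fin_homD(3)[OF assms] by (simp add: smash_map_def extensional_def)
  qed
qed

section \<open>From the cube to the iterated delooping\<close>

text \<open>
  The nested smash \<open>i\<^sub>1 \<and> (\<dots> \<and> (i\<^sub>n \<and> j))\<close> in \<open>\<langle>k\<^sub>1\<rangle> \<and> (\<dots> \<and> (\<langle>k\<^sub>n\<rangle> \<and> \<langle>m\<rangle>))\<close>, where \<open>i\<^sub>r\<close> is the class of
  the \<open>r\<close>-th simplex and \<open>j \<in> \<langle>m\<rangle>\<close>. A delooping replaces \<open>\<langle>m\<rangle>\<close> by \<open>\<langle>k\<rangle> \<and> \<langle>m\<rangle>\<close> for the last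
  entry \<open>k\<close> of the multidegree, so the recursion removes last entries and needs \<open>m\<close> and \<open>j\<close> as
  varying parameters, although only \<open>m = j = 1\<close> enters into the sphere.
\<close>

primrec cube_index ::
  "nat \<Rightarrow> nat list \<Rightarrow> nat \<Rightarrow> (nat \<Rightarrow> nat) list \<Rightarrow> nat \<Rightarrow> nat" where
  "cube_index 0 ks m fs j = j"
| "cube_index (Suc n) ks m fs j =
     cube_index n (butlast ks) (last ks * m) (butlast fs)
       (smash_elem m (circle_index (last ks) (last fs)) j)"

lemma deloop_simps:
  "elems (deloop X) ks m = elems X (butlast ks) (last ks * m)"
  "act (deloop X) ks m ls p fs g =
     act X (butlast ks) (last ks * m) (butlast ls) (last ls * p) (butlast fs)
       (smash_map (last ks) m p (s_map (last ks) (last ls) (last fs)) g)"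
  by (simp_all add: deloop_def)

lemma cube_cell_snoc:
  assumes "fs \<in> multi_hom ks (replicate (Suc n) 1)"
  shows "butlast fs \<in> multi_hom (butlast ks) (replicate n 1)" "last fs \<in> delta_hom (last ks) 1"
    and "fs \<noteq> []" "ks \<noteq> []"
proof -
  have "butlast (replicate (Suc n) (1::nat)) = replicate n 1"
    by (metis butlast_snoc replicate_Suc replicate_append_same)
  moreover have "last (replicate (Suc n) (1::nat)) = 1" by (simp add: last_replicate)
  ultimately show "butlast fs \<in> multi_hom (butlast ks) (replicate n 1)"
    "last fs \<in> delta_hom (last ks) 1"
    using multi_hom_snoc[OF assms] by (simp_all del: replicate_Suc)
  show "fs \<noteq> []" "ks \<noteq> []" using multi_homD[OF assms] by auto
qed

lemma cube_index_basepoint: "cube_index n ks m fs 0 = 0"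
  by (induction n arbitrary: ks m fs) (simp_all add: smash_elem_def)

lemma cube_index_in_elems:
  assumes "fs \<in> multi_hom ks (replicate n 1)" "j \<le> m"
  shows "cube_index n ks m fs j \<in> elems ((deloop ^^ n) F1) ks m"
  using assms
proof (induction n arbitrary: ks m fs j)
  case 0
  then show ?case by (simp add: F1_def)
next
  case (Suc n)
  note c = cube_cell_snoc[OF Suc.prems(1)]
  show ?case
    using Suc.IH[OF c(1) smash_elem_le[OF circle_index_le[OF c(2)] Suc.prems(2)]]
    by (simp add: deloop_simps)
qed

text \<open>
  Naturality in all variables. Each delooping acts by a smash of maps, and this acts factor by factor
  on a smash of points; on the factor from the circle it is naturality of the class of a simplex.
\<close>

lemma act_cube_index:
  assumes "fs \<in> multi_hom ks (replicate n 1)" "\<alpha>s \<in> multi_hom ls ks" "g \<in> fin_hom m p" "j \<le> m"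
  shows "act ((deloop ^^ n) F1) ks m ls p \<alpha>s g (cube_index n ks m fs j) =
    cube_index n ls p (multi_comp ls fs \<alpha>s) (g j)"
  using assms
proof (induction n arbitrary: ks m ls p fs \<alpha>s g j)
  case 0
  then show ?case by (simp add: F1_def)
next
  case (Suc n)
  note c = cube_cell_snoc[OF Suc.prems(1)]
  note a = multi_hom_snoc[OF Suc.prems(2) c(4)]
  have l: "length fs = length ls" "length \<alpha>s = length ls" "ls \<noteq> []"
    using multi_homD[OF Suc.prems(1)] multi_homD[OF Suc.prems(2)] c(4) by auto
  let ?i = "circle_index (last ks) (last fs)" and ?s = "s_map (last ks) (last ls) (last \<alpha>s)"
  have s: "?s \<in> fin_hom (last ks) (last ls)" by (rule s_map_hom[OF a(2)])
  have i: "?i \<le> last ks" by (rule circle_index_le[OF c(2)])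
  have "act ((deloop ^^ Suc n) F1) ks m ls p \<alpha>s g (cube_index (Suc n) ks m fs j) =
    cube_index n (butlast ls) (last ls * p) (multi_comp (butlast ls) (butlast fs) (butlast \<alpha>s))
      (smash_map (last ks) m p ?s g (smash_elem m ?i j))"
    using Suc.IH[OF c(1) a(1) smash_map_hom[OF s Suc.prems(3)] smash_elem_le[OF i Suc.prems(4)]]
    by (simp add: deloop_simps)
  also have "smash_map (last ks) m p ?s g (smash_elem m ?i j) = smash_elem p (?s ?i) (g j)"
    using i Suc.prems(4) fin_homD(2)[OF s] fin_homD(2)[OF Suc.prems(3)] by (rule smash_map_elem)
  also have "?s ?i = circle_index (last ls) (compose {0..last ls} (last fs) (last \<alpha>s))"
    by (rule circle_index_compose[OF c(2) a(2), symmetric])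
  finally show ?case by (simp add: multi_comp_snoc[OF l])
qed

lemma cube_index_eq_0_iff:
  assumes "length ks = n" "length fs = n"
  shows "cube_index n ks m fs j = 0 \<longleftrightarrow> j = 0 \<or> (\<exists>i<n. circle_index (ks ! i) (fs ! i) = 0)"
  using assms
proof (induction n arbitrary: ks m fs j)
  case (Suc n)
  have "last ks = ks ! n" "last fs = fs ! n"
    using Suc.prems last_conv_nth[of ks] last_conv_nth[of fs] by fastforce+
  then show ?case
    using Suc by (auto simp: smash_elem_eq_0_iff less_Suc_eq nth_butlast)
qed simp

lemma cube_index_inj:
  assumes "fs \<in> multi_hom ks (replicate n 1)" "fs' \<in> multi_hom ks (replicate n 1)" "j \<le> m" "j' \<le> m"
    and "cube_index n ks m fs j = cube_index n ks m fs' j'" "cube_index n ks m fs j \<noteq> 0"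
  shows "fs = fs' \<and> j = j'"
  using assms
proof (induction n arbitrary: ks m fs fs' j j')
  case 0
  then show ?case by (auto simp: multi_hom_def)
next
  case (Suc n)
  note c = cube_cell_snoc[OF Suc.prems(1)] and c' = cube_cell_snoc[OF Suc.prems(2)]
  let ?i = "circle_index (last ks) (last fs)" and ?i' = "circle_index (last ks) (last fs')"
  have b: "butlast fs = butlast fs' \<and> smash_elem m ?i j = smash_elem m ?i' j'"
    using Suc.prems(5,6)
    by (intro Suc.IH[OF c(1) c'(1) smash_elem_le[OF circle_index_le[OF c(2)] Suc.prems(3)]
        smash_elem_le[OF circle_index_le[OF c'(2)] Suc.prems(4)]]) auto
  have nz: "smash_elem m ?i j \<noteq> 0"
    using Suc.prems(6) cube_index_basepoint[of n] by (metis cube_index.simps(2))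
  then have "?i = ?i' \<and> j = j'" using smash_elem_inj[of m ?i j ?i' j'] b Suc.prems(3,4) by blast
  moreover have "?i \<noteq> 0" using nz by (simp add: smash_elem_eq_0_iff)
  ultimately have "last fs = last fs' \<and> j = j'" using circle_index_inj[OF c(2) c'(2)] by blast
  then show ?case using b c(3) c'(3) by (metis append_butlast_last_id)
qed

text \<open>
  One delooping at a time, a point of \<open>\<langle>k\<rangle> \<and> \<langle>m\<rangle>\<close> splits into its factors and the factor in \<open>\<langle>k\<rangle>\<close> is
  the class of some simplex.
\<close>

lemma cube_index_surj:
  assumes "x \<in> elems ((deloop ^^ n) F1) ks m" "length ks = n"
  shows "\<exists>fs\<in>multi_hom ks (replicate n 1). \<exists>j\<le>m. cube_index n ks m fs j = x"
  using assms
proof (induction n arbitrary: ks m)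
  case 0
  then show ?case by (simp add: F1_def multi_hom_def)
next
  case (Suc n)
  from Suc.prems obtain fs p where fs: "fs \<in> multi_hom (butlast ks) (replicate n 1)"
    "p \<le> last ks * m" "cube_index n (butlast ks) (last ks * m) fs p = x"
    using Suc.IH[of "butlast ks" "last ks * m"] by (auto simp: deloop_simps)
  obtain i j where ij: "i \<le> last ks" "j \<le> m" "p = smash_elem m i j"
    using smash_elem_surj[OF fs(2)] .
  obtain f where f: "f \<in> delta_hom (last ks) 1" "circle_index (last ks) f = i"
    using circle_index_surj[OF ij(1)] .
  have ne: "ks \<noteq> []" using Suc.prems(2) by auto
  have "fs @ [f] \<in> multi_hom (butlast ks @ [last ks]) (replicate n 1 @ [1])"
    using fs(1) f(1) by (auto simp: multi_hom_def nth_append)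
  then have "fs @ [f] \<in> multi_hom ks (replicate (Suc n) 1)"
    using ne by (simp add: replicate_append_same)
  moreover have "cube_index (Suc n) ks m (fs @ [f]) j = x"
    using fs(3) f(2) ij(3) by simp
  ultimately show ?case using ij(2) by blast
qed

section \<open>The boundary of the cube\<close>

text \<open>
  A simplex has class \<open>0\<close> exactly when it is constant. A face obtained by restricting in
  direction \<open>i\<close> has an \<open>i\<close>-th component with source \<open>[0]\<close>, and precomposition with any operator keeps
  this component constant. Conversely a
  cell whose \<open>i\<close>-th component is constant with value \<open>c\<close> factors through the face in direction \<open>i\<close>
  given by \<open>0 \<mapsto> c\<close>.
\<close>

lemma square_boundary_iff:
  "(ks, x) \<in> square_boundary n \<longleftrightarrow>
     x \<in> multi_hom ks (replicate n 1) \<and> (\<exists>i<n. circle_index (ks ! i) (x ! i) = 0)"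
proof
  assume "(ks, x) \<in> square_boundary n"
  then show "x \<in> multi_hom ks (replicate n 1) \<and> (\<exists>i<n. circle_index (ks ! i) (x ! i) = 0)"
    unfolding square_boundary_def
  proof (induction rule: generated.induct)
    case (gen ks x)
    then obtain i \<delta> where i: "i < n" "\<delta> \<in> delta_hom 0 1" and ks: "ks = (replicate n 1)[i := 0]"
      and x: "x = multi_comp ks (multi_id (replicate n 1)) ((multi_id (replicate n 1))[i := \<delta>])"
      by (auto simp: square_faces_def square_def)
    have "(multi_id (replicate n 1))[i := \<delta>] \<in> multi_hom ks (replicate n 1)"
      using i multi_id_hom[of "replicate n 1"] unfolding ks
      by (auto simp: multi_hom_def nth_list_update)
    then have x: "x \<in> multi_hom ks (replicate n 1)"
      unfolding x by (rule multi_comp_hom[OF multi_id_hom])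
    have "x ! i \<in> delta_hom (ks ! i) 1" "ks ! i = 0"
      using multi_homD(3)[OF x, of i] i(1) by (simp_all add: ks)
    then have "circle_index (ks ! i) (x ! i) = 0" using circle_index_le by fastforce
    then show ?case using x i(1) by blast
  next
    case (oper ks x fs ls)
    then obtain i where x: "x \<in> multi_hom ks (replicate n 1)" and i: "i < n"
      and z: "circle_index (ks ! i) (x ! i) = 0" by blast
    have l: "length ks = n" "length ls = n"
      using multi_homD[OF x] multi_homD[OF oper.hyps(2)] by auto
    have "x ! i \<in> delta_hom (ks ! i) 1" "fs ! i \<in> delta_hom (ls ! i) (ks ! i)"
      using multi_homD(3)[OF x, of i] multi_homD(3)[OF oper.hyps(2), of i] i l by simp_all
    then have "circle_index (ls ! i) (multi_comp ls x fs ! i) = 0"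
      using circle_index_compose z i l fin_homD(2)[OF s_map_hom] by (simp add: multi_comp_nth)
    then show ?case using multi_comp_hom[OF x oper.hyps(2)] i by (auto simp: square_def)
  qed
next
  assume "x \<in> multi_hom ks (replicate n 1) \<and> (\<exists>i<n. circle_index (ks ! i) (x ! i) = 0)"
  then obtain i where x: "x \<in> multi_hom ks (replicate n 1)" and i: "i < n"
    and z: "circle_index (ks ! i) (x ! i) = 0" by blast
  have l: "length ks = n" "length x = n" using multi_homD[OF x] by auto
  have "x ! i \<in> delta_hom (ks ! i) 1" using multi_homD(3)[OF x, of i] i l by simp
  then obtain c where c: "c \<le> 1" "x ! i = (\<lambda>j\<in>{0..ks ! i}. c)"
    by (rule circle_index_cases) (use z in auto)
  \<comment> \<open>The cell is \<open>d \<circ> fs\<close>, where \<open>d\<close> is the face given by \<open>c\<close> in direction \<open>i\<close>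
    and \<open>fs\<close> replaces the constant component by the map to \<open>[0]\<close>.\<close>
  define \<delta> where "\<delta> = (\<lambda>j\<in>{0..0::nat}. c)"
  have \<delta>: "\<delta> \<in> delta_hom 0 1" using c(1) by (auto simp: \<delta>_def delta_hom_def mono_on_def)
  define ms where "ms = (replicate n (1::nat))[i := 0]"
  define d where "d = (multi_id (replicate n 1))[i := \<delta>]"
  define fs where "fs = x[i := (\<lambda>j\<in>{0..ks ! i}. 0)]"
  have d: "d \<in> multi_hom ms (replicate n 1)"
    using i \<delta> multi_id_hom[of "replicate n 1"] unfolding ms_def d_def
    by (auto simp: multi_hom_def nth_list_update)
  have "(ms, oper (square n) (replicate n 1) ms d (multi_id (replicate n 1))) \<in> square_faces n"
    using i \<delta> unfolding square_faces_def ms_def d_def by blast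
  then have "(ms, d) \<in> square_boundary n"
    using multi_comp_id_left[OF d] unfolding square_boundary_def
    by (intro generated.gen) (simp add: square_def)
  moreover have fs: "fs \<in> multi_hom ks ms"
    using x i l unfolding fs_def ms_def
    by (auto simp: multi_hom_def nth_list_update delta_hom_def mono_on_def)
  ultimately have "(ks, oper (square n) ms ks fs d) \<in> square_boundary n"
    unfolding square_boundary_def by (rule generated.oper)
  moreover have "multi_comp ks d fs = x"
  proof (rule nth_equalityI)
    fix r assume "r < length (multi_comp ks d fs)"
    then have r: "r < n" using l by (simp add: multi_comp_nth)
    show "multi_comp ks d fs ! r = x ! r"
    proof (cases "r = i")
      case True
      then show ?thesis using i l c(2)
        by (auto simp: multi_comp_nth d_def fs_def \<delta>_def multi_id_def compose_def)
    next
      case False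
      then have "multi_comp ks d fs ! r = multi_comp ks (multi_id (replicate n 1)) x ! r"
        using r l by (simp add: multi_comp_nth d_def fs_def)
      then show ?thesis using multi_comp_id_left[OF x] by simp
    qed
  qed (use l in \<open>simp add: multi_comp_nth\<close>)
  ultimately show "(ks, x) \<in> square_boundary n" by (simp add: square_def)
qed

section \<open>The sphere\<close>

text \<open>
  Here \<open>n \<ge> 1\<close> is essential: the basepoint must come from a cell with a constant component. For
  \<open>n = 0\<close> the cube is a point, while \<open>F1\<langle>1\<rangle>\<close> has two elements.
\<close>

lemma cube_index_image:
  assumes n: "n \<ge> 1" and ks: "length ks = n"
  shows "(\<lambda>fs. cube_index n ks 1 fs 1) ` multi_hom ks (replicate n 1) =
    elems ((deloop ^^ n) F1) ks 1"
proof
  show "(\<lambda>fs. cube_index n ks 1 fs 1) ` multi_hom ks (replicate n 1) \<subseteq>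
      elems ((deloop ^^ n) F1) ks 1"
    using cube_index_in_elems by auto
  show "elems ((deloop ^^ n) F1) ks 1 \<subseteq>
      (\<lambda>fs. cube_index n ks 1 fs 1) ` multi_hom ks (replicate n 1)"
  proof
    fix x assume "x \<in> elems ((deloop ^^ n) F1) ks 1"
    then obtain fs j where fs: "fs \<in> multi_hom ks (replicate n 1)" "j \<le> 1"
      "cube_index n ks 1 fs j = x"
      using cube_index_surj[OF _ ks] by blast
    show "x \<in> (\<lambda>fs. cube_index n ks 1 fs 1) ` multi_hom ks (replicate n 1)"
    proof (cases "j = 0")
      case True
      then have x: "x = 0" using fs(3) cube_index_eq_0_iff[OF ks] multi_homD(1)[OF fs(1)] ks by auto
      define hs where "hs = map (\<lambda>k. \<lambda>j\<in>{0..k}. 0::nat) ks"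
      have hs: "hs \<in> multi_hom ks (replicate n 1)"
        using ks by (auto simp: hs_def multi_hom_def delta_hom_def mono_on_def)
      have "circle_index (ks ! 0) (hs ! 0) = 0"
        using n ks by (auto simp: hs_def circle_index_def)
      then have "\<exists>i<n. circle_index (ks ! i) (hs ! i) = 0" using n by (intro exI[of _ 0]) simp
      then have "cube_index n ks 1 hs 1 = 0"
        using cube_index_eq_0_iff[OF ks] multi_homD(1)[OF hs] ks by simp
      then show ?thesis using hs x by force
    next
      case False
      then show ?thesis using fs by (metis image_eqI le_antisym less_one not_le)
    qed
  qed
qed

lemma cube_index_kernel:
  assumes "x \<in> multi_hom ks (replicate n 1)" "y \<in> multi_hom ks (replicate n 1)"
  shows "cube_index n ks 1 x 1 = cube_index n ks 1 y 1 \<longleftrightarrow>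
    x = y \<or> (ks, x) \<in> square_boundary n \<and> (ks, y) \<in> square_boundary n"
proof -
  have b: "(ks, z) \<in> square_boundary n \<longleftrightarrow> cube_index n ks 1 z 1 = 0"
    if "z \<in> multi_hom ks (replicate n 1)" for z
    using that multi_homD(1,2)[OF that] by (simp add: square_boundary_iff cube_index_eq_0_iff)
  show ?thesis
    unfolding b[OF assms(1)] b[OF assms(2)]
    using cube_index_inj[OF assms order_refl order_refl] by metis
qed

text \<open>
  Stated for any \<open>Y\<close> with the cells and operators of the iterated delooping at \<open>\<langle>1\<rangle>\<close>, so as to cover
  the bar construction: its operators agree with these on morphisms of \<open>\<Delta>\<^sup>n\<close>, but are different
  functions on other arguments.
\<close>

lemma nfold_iso_sphere:
  assumes "n \<ge> 1"
    and cells: "\<And>ks. length ks = n \<Longrightarrow> cells Y ks = elems ((deloop ^^ n) F1) ks 1"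
    and oper: "\<And>ks ls fs. length ks = n \<Longrightarrow> length ls = n \<Longrightarrow> fs \<in> multi_hom ls ks \<Longrightarrow>
      oper Y ks ls fs = act ((deloop ^^ n) F1) ks 1 ls 1 fs (id_map 1)"
  shows "nfold_iso n Y (sphere n)"
  unfolding sphere_def
proof (rule nfold_iso_collapse[OF nfold_sset_square])
  have id: "id_map 1 \<in> fin_hom 1 1" by (auto simp: fin_hom_def)
  show "nfold_surj n (square n) Y (\<lambda>ks fs. cube_index n ks 1 fs 1)"
    unfolding nfold_surj_def
  proof (intro conjI allI impI ballI)
    fix ks :: "nat list" assume "length ks = n"
    then show "(\<lambda>fs. cube_index n ks 1 fs 1) ` cells (square n) ks = cells Y ks"
      using cube_index_image[OF assms(1)] cells by (simp add: square_def)
  next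
    fix ks ls :: "nat list" and \<alpha>s x
    assume l: "length ks = n" "length ls = n" and \<alpha>s: "\<alpha>s \<in> multi_hom ls ks"
      and "x \<in> cells (square n) ks"
    then have x: "x \<in> multi_hom ks (replicate n 1)" by (simp add: square_def)
    show "cube_index n ls 1 (oper (square n) ks ls \<alpha>s x) 1 =
        oper Y ks ls \<alpha>s (cube_index n ks 1 x 1)"
      using act_cube_index[OF x \<alpha>s id order_refl] by (simp add: square_def oper[OF l \<alpha>s])
  qed
next
  fix ks :: "nat list" and x y
  assume "x \<in> cells (square n) ks" "y \<in> cells (square n) ks"
  then have "x \<in> multi_hom ks (replicate n 1)" "y \<in> multi_hom ks (replicate n 1)"
    by (simp_all add: square_def)
  then show "cube_index n ks 1 x 1 = cube_index n ks 1 y 1 \<longleftrightarrow>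
      x = y \<or> (ks, x) \<in> square_boundary n \<and> (ks, y) \<in> square_boundary n"
    by (rule cube_index_kernel)
qed

theorem corollary3p9:
  fixes n :: nat
  assumes "n \<ge> 1"
  shows "nfold_iso n (level ((deloop ^^ n) F1) 1) (sphere n) \<and>
         nfold_iso n (bar ((deloop ^^ (n - 1)) F1)) (sphere n)"
proof
  show "nfold_iso n (level ((deloop ^^ n) F1) 1) (sphere n)"
    by (rule nfold_iso_sphere[OF assms]) (simp_all add: level_def)
  obtain r where r: "n = Suc r" using assms by (cases n) auto
  show "nfold_iso n (bar ((deloop ^^ (n - 1)) F1)) (sphere n)"
  proof (rule nfold_iso_sphere[OF assms])
    fix ks ls :: "nat list" and fs
    assume "length ks = n" and fs: "fs \<in> multi_hom ls ks"
    then have "ks \<noteq> []" using assms by auto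
    from smash_map_unit_right[OF s_map_hom[OF multi_hom_snoc(2)[OF fs this]]]
    show "oper (bar ((deloop ^^ (n - 1)) F1)) ks ls fs =
      act ((deloop ^^ n) F1) ks 1 ls 1 fs (id_map 1)"
      by (simp add: bar_def deloop_simps r)
  qed (simp add: bar_def deloop_simps r)
qed

end
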